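(* Let $X_{t,s}=x+tD-sD^2$ and let $T_{n,k}(x,t,s)$ be the normal-ordering coefficients defined by $X_{t,s}^n=\sum_{k=0}^{2n}T_{n,k}(x,t,s)D^k$. For every $n\ge0$ and $k\ge0$, $$T_{n+1,k}=xT_{n,k}+t\frac{\partial T_{n,k}}{\partial x}-s\frac{\partial^2T_{n,k}}{\partial x^2}+tT_{n,k-1}-2s\frac{\partial T_{n,k-1}}{\partial x}-sT_{n,k-2}.$$
   Context: $D=\frac{d}{dx}$; $x$ denotes multiplication by $x$, so $X_{t,s}$ and its powers are polynomial differential operators in $x$ (with parameters $t,s$). Every such operator is written uniquely in normal form with all powers of $D$ on the right. Conventions: $T_{n,k}\equiv0$ for $k<0$ and for $k>2n$, and $T_{0,0}=1$. *)

theory Defs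
  imports "HOL-Computational_Algebra.Polynomial"
begin

text \<open>
  Operators act on polynomials in \<open>x\<close> over an integral domain of characteristic zero, a setting in
  which the normal form of a polynomial differential operator is unique. The parameters \<open>t\<close>, \<open>s\<close> are
  arbitrary elements of the coefficient domain: they may be numbers, or the two indeterminates of
  a polynomial ring such as \<open>rat poly poly\<close>. In the latter reading \<open>pderiv\<close> on \<open>'a poly\<close> is the
  partial derivative with respect to \<open>x\<close>.
\<close>

definition X_op :: "'a::{idom, ring_char_0} \<Rightarrow> 'a \<Rightarrow> 'a poly \<Rightarrow> 'a poly" where
  "X_op t s p = [:0, 1:] * p + smult t (pderiv p) - smult s (pderiv (pderiv p))"

definition is_normal_form ::
    "('a::{idom, ring_char_0} poly \<Rightarrow> 'a poly) \<Rightarrow> nat \<Rightarrow> (nat \<Rightarrow> 'a poly) \<Rightarrow> bool" where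
  "is_normal_form L m c \<longleftrightarrow>
     (\<forall>k>m. c k = 0) \<and> (\<forall>p. L p = (\<Sum>k=0..m. c k * (pderiv ^^ k) p))"

text \<open>The index \<open>k\<close> is an integer, so that \<open>k - 1\<close> and \<open>k - 2\<close> may be negative.\<close>

definition T :: "'a::{idom, ring_char_0} \<Rightarrow> 'a \<Rightarrow> nat \<Rightarrow> int \<Rightarrow> 'a poly" where
  "T t s n k =
     (if k < 0 then 0 else (THE c. is_normal_form (X_op t s ^^ n) (2 * n) c) (nat k))"

text \<open>The remaining facts show that the description in the definition of \<open>T\<close> is proper.\<close>

lemma is_normal_form_unique:
  assumes c: "is_normal_form L m c" and d: "is_normal_form L m d"
  shows "c = d"
proof (rule ccontr)
  assume "c \<noteq> d"
  then have ex: "\<exists>k. c k \<noteq> d k" by auto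
  define j where "j = (LEAST k. c k \<noteq> d k)"
  have j: "c j \<noteq> d j" unfolding j_def using ex by (rule LeastI_ex)
  have less: "c k = d k" if "k < j" for k
    using not_less_Least[of k "\<lambda>k. c k \<noteq> d k"] that unfolding j_def by blast
  have jm: "j \<le> m"
    using j c d unfolding is_normal_form_def by (metis not_le)
  have high: "(pderiv ^^ k) (monom (1::'a) j) = 0" if "j < k" for k
  proof (rule poly_eqI)
    fix n
    from that have "coeff (monom (1::'a) j) (n + k) = 0" by simp
    then show "coeff ((pderiv ^^ k) (monom (1::'a) j)) n = coeff 0 n"
      by (simp only: coeff_higher_pderiv mult_zero_right coeff_0)
  qed
  have diag: "(pderiv ^^ j) (monom (1::'a) j) = [:fact j:]"
    by (rule poly_eqI) (simp add: coeff_higher_pderiv pochhammer_fact coeff_pCons split: nat.split)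
  define u where "u = monom (1::'a) j"
  have "0 = (\<Sum>k=0..m. c k * (pderiv ^^ k) u) - (\<Sum>k=0..m. d k * (pderiv ^^ k) u)"
  proof -
    have "L u = (\<Sum>k=0..m. c k * (pderiv ^^ k) u)" "L u = (\<Sum>k=0..m. d k * (pderiv ^^ k) u)"
      using c d by (simp_all only: is_normal_form_def)
    then show ?thesis by simp
  qed
  also have "\<dots> = (\<Sum>k=0..m. (c k - d k) * (pderiv ^^ k) u)"
    by (simp add: sum_subtractf left_diff_distrib)
  also have "\<dots> = (\<Sum>k=0..m. if k = j then (c j - d j) * [:fact j:] else 0)"
  proof (rule sum.cong)
    fix k
    consider "k < j" | "k = j" | "j < k" by linarith
    then show "(c k - d k) * (pderiv ^^ k) u = (if k = j then (c j - d j) * [:fact j:] else 0)"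
      by cases (simp_all add: u_def diag less high)
  qed simp
  also have "\<dots> = (c j - d j) * [:fact j:]"
    using jm by simp
  finally show False using j by simp
qed

lemma normal_form_X_op_step:
  assumes "is_normal_form L m c"
  shows "\<exists>d. is_normal_form (X_op t s \<circ> L) (m + 2) d"
proof -
  have D: "\<exists>d. is_normal_form (pderiv \<circ> L) (Suc m) d"
    if L: "is_normal_form L m c" for L :: "'a poly \<Rightarrow> 'a poly" and m c
  proof (intro exI)
    let ?d = "\<lambda>k. pderiv (c k) + (case k of 0 \<Rightarrow> 0 | Suc i \<Rightarrow> c i)"
    have c0: "c k = 0" if "k > m" for k using L that by (simp add: is_normal_form_def)
    have "pderiv (L p) = (\<Sum>k=0..Suc m. ?d k * (pderiv ^^ k) p)" for p
    proof -
      have "pderiv (L p) = (\<Sum>k=0..m. pderiv (c k) * (pderiv ^^ k) p)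
          + (\<Sum>k=0..m. c k * (pderiv ^^ Suc k) p)"
        using L by (simp add: is_normal_form_def higher_pderiv_sum[of 1, simplified] pderiv_mult sum.distrib algebra_simps)
      also have "(\<Sum>k=0..m. pderiv (c k) * (pderiv ^^ k) p)
          = (\<Sum>k=0..Suc m. pderiv (c k) * (pderiv ^^ k) p)"
        by (simp add: c0)
      also have "(\<Sum>k=0..m. c k * (pderiv ^^ Suc k) p)
          = (\<Sum>k=0..Suc m. (case k of 0 \<Rightarrow> 0 | Suc i \<Rightarrow> c i) * (pderiv ^^ k) p)"
        by (subst sum.atLeast0_atMost_Suc_shift) simp
      finally show ?thesis by (simp only: sum.distrib distrib_right)
    qed
    then show "is_normal_form (pderiv \<circ> L) (Suc m) ?d"
      by (auto simp: is_normal_form_def c0 split: nat.split)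
  qed
  have mono: "is_normal_form L m' c" if "is_normal_form L m c" "m \<le> m'"
    for L :: "'a poly \<Rightarrow> 'a poly" and m m' c
  proof -
    have "(\<Sum>k=0..m. c k * (pderiv ^^ k) p) = (\<Sum>k=0..m'. c k * (pderiv ^^ k) p)" for p
      using that by (intro sum.mono_neutral_left) (auto simp: is_normal_form_def)
    with that show ?thesis by (auto simp: is_normal_form_def)
  qed
  obtain d where d: "is_normal_form (pderiv \<circ> L) (Suc m) d" using D[OF assms] by blast
  obtain e where e: "is_normal_form (pderiv \<circ> (pderiv \<circ> L)) (m + 2) e"
    using D[OF d] by auto
  have d': "is_normal_form (pderiv \<circ> L) (m + 2) d" using mono[OF d] by simp
  have c': "is_normal_form L (m + 2) c" using mono[OF assms] by simp
  have "is_normal_form (X_op t s \<circ> L) (m + 2)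
      (\<lambda>k. [:0, 1:] * c k + smult t (d k) - smult s (e k))"
    unfolding is_normal_form_def
  proof (intro conjI allI impI)
    fix k assume "k > m + 2"
    then show "[:0, 1:] * c k + smult t (d k) - smult s (e k) = 0"
      using c' d' e by (simp add: is_normal_form_def)
  next
    fix p
    have "L p = (\<Sum>k=0..m+2. c k * (pderiv ^^ k) p)"
      "pderiv (L p) = (\<Sum>k=0..m+2. d k * (pderiv ^^ k) p)"
      "pderiv (pderiv (L p)) = (\<Sum>k=0..m+2. e k * (pderiv ^^ k) p)"
      using c' d' e by (simp_all only: is_normal_form_def o_def)
    then have "(X_op t s \<circ> L) p = [:0, 1:] * (\<Sum>k=0..m+2. c k * (pderiv ^^ k) p)
       + smult t (\<Sum>k=0..m+2. d k * (pderiv ^^ k) p) - smult s (\<Sum>k=0..m+2. e k * (pderiv ^^ k) p)"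
      by (simp only: X_op_def o_def)
    moreover have smult_sum: "smult a (sum f A) = (\<Sum>k\<in>A. smult a (f k))"
      for a :: 'a and f :: "nat \<Rightarrow> 'a poly" and A
      by (induction A rule: infinite_finite_induct) (simp_all add: smult_add_right)
    ultimately show "(X_op t s \<circ> L) p =
        (\<Sum>k=0..m+2. ([:0, 1:] * c k + smult t (d k) - smult s (e k)) * (pderiv ^^ k) p)"
      by (simp only: sum_distrib_left smult_sum sum.distrib sum_subtractf left_diff_distrib
          distrib_right mult.assoc mult_smult_left)
  qed
  then show ?thesis by blast
qed

theorem normal_form_X_op_power_ex1: "\<exists>!c. is_normal_form (X_op t s ^^ n) (2 * n) c"
proof (rule ex_ex1I)
  show "\<exists>c. is_normal_form (X_op t s ^^ n) (2 * n) c"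
  proof (induction n)
    case 0
    have "is_normal_form (X_op t s ^^ 0) (2 * 0) (\<lambda>k. if k = 0 then 1 else 0)"
      by (simp add: is_normal_form_def)
    then show ?case by blast
  next
    case (Suc n)
    then obtain c where c: "is_normal_form (X_op t s ^^ n) (2 * n) c" by blast
    show ?case using normal_form_X_op_step[OF c, of t s] by (simp add: o_def)
  qed
qed (rule is_normal_form_unique)

end

theory Submission
  imports Defs
begin

text \<open>Write the (n+1)-st power of \<open>X_op t s\<close> as \<open>X_op t s\<close> applied
  after the n-th power L, with normal form \<Sum> c_k D^k. By the Leibniz rule D (c_k D^k) = c_k'
  D^k + c_k D^(k+1), so D L has coefficients c_k' + c_(k-1), and D^2 L has c_k'' + 2 c_(k-1)' +
  c_(k-2). Combining these with the factors x, t and -s gives a normal form of the next power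
  (\<open>is_normal_form_pderiv\<close> and the closure lemmas). Since normal forms are unique
  (\<open>is_normal_form_unique\<close>), its coefficients are those named by \<open>T\<close>,
  which is the recurrence.\<close>

lemma is_normal_form_mono:
  assumes "is_normal_form L m c" "m \<le> m'"
  shows "is_normal_form L m' c"
proof -
  have "(\<Sum>k=0..m. c k * (pderiv ^^ k) p) = (\<Sum>k=0..m'. c k * (pderiv ^^ k) p)" for p
    using assms by (intro sum.mono_neutral_left) (auto simp: is_normal_form_def)
  with assms show ?thesis by (auto simp: is_normal_form_def)
qed

lemma is_normal_form_mult:
  "is_normal_form L m c \<Longrightarrow> is_normal_form (\<lambda>p. q * L p) m (\<lambda>k. q * c k)"
  by (simp add: is_normal_form_def sum_distrib_left mult.assoc)

lemma is_normal_form_smult: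
  "is_normal_form L m c \<Longrightarrow> is_normal_form (\<lambda>p. smult a (L p)) m (\<lambda>k. smult a (c k))"
  using is_normal_form_mult[of L m c "[:a:]"] by simp

lemma is_normal_form_add:
  "is_normal_form L m c \<Longrightarrow> is_normal_form M m d \<Longrightarrow>
    is_normal_form (\<lambda>p. L p + M p) m (\<lambda>k. c k + d k)"
  by (simp add: is_normal_form_def sum.distrib distrib_right)

lemma is_normal_form_diff:
  "is_normal_form L m c \<Longrightarrow> is_normal_form M m d \<Longrightarrow>
    is_normal_form (\<lambda>p. L p - M p) m (\<lambda>k. c k - d k)"
  by (simp add: is_normal_form_def sum_subtractf left_diff_distrib)

text \<open>This is the Leibniz rule on operators: differentiating c_k D^k either hits the
  coefficient or raises the order. The \<open>case\<close> encodes c_(k-1), taken as 0 at k =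
  0.\<close>

lemma is_normal_form_pderiv:
  assumes "is_normal_form L m c"
  shows "is_normal_form (\<lambda>p. pderiv (L p)) (Suc m)
    (\<lambda>k. pderiv (c k) + (case k of 0 \<Rightarrow> 0 | Suc i \<Rightarrow> c i))"
proof -
  let ?d = "\<lambda>k. pderiv (c k) + (case k of 0 \<Rightarrow> 0 | Suc i \<Rightarrow> c i)"
  have c0: "c k = 0" if "k > m" for k using assms that by (simp add: is_normal_form_def)
  have "pderiv (L p) = (\<Sum>k=0..Suc m. ?d k * (pderiv ^^ k) p)" for p
  proof -
    have "pderiv (L p) = (\<Sum>k=0..m. pderiv (c k) * (pderiv ^^ k) p)
        + (\<Sum>k=0..m. c k * (pderiv ^^ Suc k) p)"
      using assms
      \<comment> \<open>The instance of \<open>higher_pderiv_sum\<close> at order 1 moves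
        \<open>pderiv\<close> inside the finite sum.\<close>
      by (simp add: is_normal_form_def higher_pderiv_sum[of 1, simplified] pderiv_mult
          sum.distrib algebra_simps)
    also have "(\<Sum>k=0..m. pderiv (c k) * (pderiv ^^ k) p)
        = (\<Sum>k=0..Suc m. pderiv (c k) * (pderiv ^^ k) p)"
      by (simp add: c0)
    also have "(\<Sum>k=0..m. c k * (pderiv ^^ Suc k) p)
        = (\<Sum>k=0..Suc m. (case k of 0 \<Rightarrow> 0 | Suc i \<Rightarrow> c i) * (pderiv ^^ k) p)"
      by (subst sum.atLeast0_atMost_Suc_shift) simp
    finally show ?thesis by (simp only: sum.distrib distrib_right)
  qed
  then show ?thesis
    by (auto simp: is_normal_form_def c0 split: nat.split)
qed

text \<open>Existence and uniqueness of the normal form make the \<open>THE\<close> in the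
  definition of \<open>T\<close> denote it.\<close>

lemma is_normal_form_T: "is_normal_form (X_op t s ^^ n) (2 * n) (\<lambda>k. T t s n (int k))"
  using theI'[OF normal_form_X_op_power_ex1[of n t s]] by (simp add: T_def)

lemma T_negative: "k < 0 \<Longrightarrow> T t s n k = 0"
  by (simp add: T_def)

text \<open>The convention that \<open>T\<close> vanishes at negative indices absorbs the boundary
  case of the shift.\<close>

lemma case_nat_T: "(case k of 0 \<Rightarrow> 0 | Suc i \<Rightarrow> T t s n (int i)) = T t s n (int k - 1)"
  by (simp add: T_negative split: nat.split)

theorem theorem4p2:
  fixes t s :: "'a::{idom, ring_char_0}" and n :: nat and k :: int
  assumes "k \<ge> 0"
  shows "T t s (n + 1) k =
      [:0, 1:] * T t s n k
      + smult t (pderiv (T t s n k))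
      - smult s (pderiv (pderiv (T t s n k)))
      + smult t (T t s n (k - 1))
      - smult (2 * s) (pderiv (T t s n (k - 1)))
      - smult s (T t s n (k - 2))"
proof -
  let ?L = "X_op t s ^^ n" and ?m = "2 * (n + 1)"
  let ?c = "\<lambda>k. T t s n (int k)"
  let ?d = "\<lambda>k. pderiv (?c k) + T t s n (int k - 1)"
  let ?e = "\<lambda>k. pderiv (?d k) + (case k of 0 \<Rightarrow> 0 | Suc i \<Rightarrow> ?d i)"
  have c: "is_normal_form ?L (2 * n) ?c"
    by (rule is_normal_form_T)
  have d: "is_normal_form (\<lambda>p. pderiv (?L p)) (Suc (2 * n)) ?d"
    using is_normal_form_pderiv[OF c] by (simp only: case_nat_T)
  have e: "is_normal_form (\<lambda>p. pderiv (pderiv (?L p))) ?m ?e"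
    using is_normal_form_pderiv[OF d] by simp
  have "is_normal_form
      (\<lambda>p. [:0, 1:] * ?L p + smult t (pderiv (?L p)) - smult s (pderiv (pderiv (?L p)))) ?m
      (\<lambda>k. [:0, 1:] * ?c k + smult t (?d k) - smult s (?e k))"
    \<comment> \<open>The three summands have order bounds 2n, 2n+1 and 2n+2; the first two are
      raised to the common bound \<open>?m\<close>.\<close>
    by (intro is_normal_form_diff is_normal_form_add is_normal_form_mult is_normal_form_smult e
        is_normal_form_mono[OF c] is_normal_form_mono[OF d]) simp_all
  then have "is_normal_form (X_op t s ^^ (n + 1)) ?m
      (\<lambda>k. [:0, 1:] * ?c k + smult t (?d k) - smult s (?e k))"
    by (simp add: X_op_def o_def)
  from is_normal_form_unique[OF is_normal_form_T this]
  have "T t s (n + 1) (int j) = [:0, 1:] * ?c j + smult t (?d j) - smult s (?e j)" for j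
    by (rule fun_cong)
  from this[of "nat k"] assms
  have "T t s (n + 1) k = [:0, 1:] * T t s n k + smult t (?d (nat k)) - smult s (?e (nat k))"
    by simp
  also have "?e (nat k) = pderiv (pderiv (T t s n k)) + 2 * pderiv (T t s n (k - 1))
      + T t s n (k - 2)"
  \<comment> \<open>The factor 2 arises because \<open>pderiv (?d k)\<close> and the shifted
    \<open>?d (k - 1)\<close> each contribute the derivative of the coefficient at k - 1. For k = 0
    all shifted terms vanish.\<close>
  proof (cases "nat k")
    case 0
    with assms show ?thesis by (simp add: T_negative pderiv_add)
  next
    case (Suc i)
    then have "k = int i + 1" by simp
    then show ?thesis using Suc by (simp add: pderiv_add add.commute)
  qed
  also have "smult s (pderiv (pderiv (T t s n k)) + 2 * pderiv (T t s n (k - 1)) + T t s n (k - 2))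
      = smult s (pderiv (pderiv (T t s n k))) + smult (2 * s) (pderiv (T t s n (k - 1)))
        + smult s (T t s n (k - 2))"
    by (simp only: smult_add_right smult_add_left mult_2)
  finally show ?thesis
    using assms by (simp add: smult_add_right algebra_simps)
qed

end
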